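(* Let $X$ be a normed space, let $F\subset X$ be a closed, bounded, convex set containing the origin as an interior point, and let $\Omega,\Omega_1,\ldots,\Omega_n$ ($n\ge 1$) be nonempty closed subsets of $X$. Assume that one of the following holds: (i) $X$ is finite dimensional, and one of the sets among $\Omega_1,\ldots,\Omega_n$ and $\Omega$ is bounded; (ii) $X$ is a reflexive Banach space, all of the sets $\Omega_1,\ldots,\Omega_n$ and $\Omega$ are weakly closed, and at least one of them is bounded. Then the smallest intersecting ball problem has a solution; that is, there exist $r\ge 0$ and $\bar x\in\Omega$ such that $$(\bar x+rF)\cap\Omega_i\neq\emptyset\quad\text{for all } i=1,\ldots,n,$$ and for any $x\in\Omega$ and $t\ge 0$ with $(x+tF)\cap\Omega_i\ne\emptyset$ for all $i=1,\ldots,n$, one has $r\le t$.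
   Context: For $x\in X$ and $r\geq 0$, $x+rF=\{x+rf: f\in F\}$. The smallest intersecting ball problem asks for a point $\bar x\in\Omega$ and the smallest $r\ge 0$ such that $\bar x+rF$ intersects all of the target sets $\Omega_1,\ldots,\Omega_n$, with the meaning of "solution" spelled out in the claim. *)

theory Defs
  imports "HOL-Analysis.Analysis"
begin

text \<open>The normed space \<open>X\<close> is the whole type \<open>'a::real_normed_vector\<close>. Its topological dual is
  the normed space \<open>'a \<Rightarrow>\<^sub>L real\<close> of bounded linear functionals.\<close>

definition finite_dimensional_space :: "'a::real_normed_vector itself \<Rightarrow> bool" where
  "finite_dimensional_space _ \<longleftrightarrow> (\<exists>B::'a set. finite B \<and> span B = UNIV)"

text \<open>Reflexivity is surjectivity of the canonical embedding into the bidual.\<close>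

definition reflexive_space :: "'a::real_normed_vector itself \<Rightarrow> bool" where
  "reflexive_space _ \<longleftrightarrow>
     (\<forall>\<phi> :: ('a \<Rightarrow>\<^sub>L real) \<Rightarrow>\<^sub>L real. \<exists>x::'a. \<forall>f :: 'a \<Rightarrow>\<^sub>L real.
        blinfun_apply \<phi> f = blinfun_apply f x)"

definition weak_topology :: "'a::real_normed_vector topology" where
  "weak_topology =
     topology_generated_by {blinfun_apply f -` U | (f :: 'a \<Rightarrow>\<^sub>L real) U. open U}"

abbreviation weakly_closed :: "'a::real_normed_vector set \<Rightarrow> bool" where
  "weakly_closed S \<equiv> closedin weak_topology S"

definition scaled_translate :: "'a::real_normed_vector \<Rightarrow> real \<Rightarrow> 'a set \<Rightarrow> 'a set" where
  "scaled_translate x r F = {x + r *\<^sub>R f | f. f \<in> F}"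

end

theory Submission
  imports Defs
begin

text \<open>By Hahn--Banach, \<open>t F\<close> is cut out by the inequalities \<open>g z \<le> t\<close>, where \<open>g\<close> ranges over the
  bounded functionals with \<open>g \<le> 1\<close> on \<open>F\<close>. So for a topology \<open>W\<close> in which these functionals are
  continuous and the target sets closed, the set \<open>A t\<close> of tuples \<open>(x, y\<^sub>1, \<dots>, y\<^sub>n)\<close> with \<open>x \<in> \<Omega>\<close>,
  \<open>y\<^sub>i \<in> \<Omega>\<^sub>i\<close> and \<open>y\<^sub>i - x \<in> t F\<close> is closed in the product topology, and it decreases with \<open>t\<close>.
  Boundedness of one set bounds all tuples, so if balls are contained in \<open>W\<close>-compact sets, the
  feasible \<open>A t\<close> have a common point, and that point is feasible for the infimum of all feasible
  \<open>t\<close>. In case (i) take for \<open>W\<close> the norm topology; in case (ii) the weak topology, where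
  compactness comes from Tychonoff's theorem applied to functionals on the dual.\<close>

section \<open>Sublinear functionals and Hahn--Banach\<close>

text \<open>Homogeneity is asked only as an inequality for positive scalars, which keeps
  verification short. Applying it to \<open>c\<close> and to \<open>1/c\<close> gives equality, and
  \<open>c = 1/2\<close> gives the value 0 at 0.\<close>

definition sublinear :: "('a::real_vector \<Rightarrow> real) \<Rightarrow> bool" where
  "sublinear p \<longleftrightarrow> (\<forall>x y. p (x + y) \<le> p x + p y) \<and> (\<forall>c>0. \<forall>x. p (c *\<^sub>R x) \<le> c * p x)"

lemma sublinear_add: "sublinear p \<Longrightarrow> p (x + y) \<le> p x + p y"
  by (simp add: sublinear_def)

lemma sublinear_zero:
  assumes "sublinear p" shows "p 0 = 0"
proof -
  have "p ((1/2) *\<^sub>R 0) \<le> (1/2) * p 0"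
    using assms unfolding sublinear_def by (meson half_gt_zero zero_less_one)
  moreover have "p (0 + 0) \<le> p 0 + p 0"
    using assms by (rule sublinear_add)
  ultimately show ?thesis by simp
qed

lemma sublinear_scale:
  assumes "sublinear p" "c \<ge> 0" shows "p (c *\<^sub>R x) = c * p x"
proof (cases "c = 0")
  case True
  then show ?thesis using sublinear_zero[OF assms(1)] by simp
next
  case False
  then have c: "c > 0" using assms by simp
  have "p ((1/c) *\<^sub>R (c *\<^sub>R x)) \<le> (1/c) * p (c *\<^sub>R x)"
    using assms(1) c unfolding sublinear_def by (meson zero_less_divide_1_iff)
  then have "c * p x \<le> p (c *\<^sub>R x)"
    using c by (simp add: field_simps)
  moreover have "p (c *\<^sub>R x) \<le> c * p x"
    using assms(1) c unfolding sublinear_def by blast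
  ultimately show ?thesis by simp
qed

lemma sublinear_minus:
  assumes "sublinear p" shows "- p (- x) \<le> p x"
  using sublinear_add[OF assms, of x "- x"] sublinear_zero[OF assms] by simp

text \<open>Additivity makes \<open>p\<close> odd, and oddness carries homogeneity over to negative
  scalars.\<close>

lemma sublinear_superadditive_imp_linear:
  assumes p: "sublinear p" and sup: "\<And>x y. p x + p y \<le> p (x + y)"
  shows "linear p"
proof (rule linearI)
  show add: "p (x + y) = p x + p y" for x y
    using sup[of x y] sublinear_add[OF p, of x y] by simp
  have neg: "p (- x) = - p x" for x
    using add[of x "- x"] sublinear_zero[OF p] by simp
  show "p (c *\<^sub>R x) = c *\<^sub>R p x" for c x
  proof (cases "c \<ge> 0")
    case True
    then show ?thesis using sublinear_scale[OF p] by simp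
  next
    case False
    then show ?thesis
      using sublinear_scale[OF p, of "- c" x] neg[of "c *\<^sub>R x"] by simp
  qed
qed

text \<open>The shift is a sublinear functional below \<open>p\<close> with value at most \<open>- p y\<close> at \<open>- y\<close>. A minimal
  sublinear functional equals all its shifts, which forces it to be superadditive.\<close>

definition sublinear_shift :: "('a::real_vector \<Rightarrow> real) \<Rightarrow> 'a \<Rightarrow> 'a \<Rightarrow> real" where
  "sublinear_shift p y x = (INF t\<in>{0..}. p (x + t *\<^sub>R y) - t * p y)"

lemma sublinear_shift_le:
  assumes p: "sublinear p" and "t \<ge> 0"
  shows "sublinear_shift p y x \<le> p (x + t *\<^sub>R y) - t * p y"
  unfolding sublinear_shift_def
proof (rule cINF_lower)
  show "bdd_below ((\<lambda>t. p (x + t *\<^sub>R y) - t * p y) ` {0..})"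
  proof (rule bdd_belowI2)
    fix t :: real assume t: "t \<in> {0..}"
    have "p (t *\<^sub>R y) \<le> p (x + t *\<^sub>R y) + p (- x)"
      using sublinear_add[OF p, of "x + t *\<^sub>R y" "- x"] by simp
    then show "- p (- x) \<le> p (x + t *\<^sub>R y) - t * p y"
      using sublinear_scale[OF p, of t y] t by simp
  qed
qed (use assms in auto)

lemma le_sublinear_shift:
  assumes "\<And>t. t \<ge> 0 \<Longrightarrow> a \<le> p (x + t *\<^sub>R y) - t * p y"
  shows "a \<le> sublinear_shift p y x"
  unfolding sublinear_shift_def by (rule cINF_greatest) (use assms in auto)

text \<open>Parameters \<open>t\<close> for \<open>x\<close> and \<open>s\<close> for
  \<open>x'\<close> combine to the admissible parameter \<open>t + s\<close> for the sum, and
  \<open>t\<close> for \<open>x\<close> becomes \<open>c * t\<close> for the multiple by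
  \<open>c\<close>.\<close>

lemma sublinear_sublinear_shift:
  assumes p: "sublinear p"
  shows "sublinear (sublinear_shift p y)"
  unfolding sublinear_def
proof (intro conjI allI impI)
  fix x x'
  let ?s = "sublinear_shift p y"
  have "?s (x + x') - ?s x \<le> ?s x'"
  proof (rule le_sublinear_shift)
    fix s :: real assume s: "s \<ge> 0"
    have "?s (x + x') - (p (x' + s *\<^sub>R y) - s * p y) \<le> ?s x"
    proof (rule le_sublinear_shift)
      fix t :: real assume t: "t \<ge> 0"
      have "?s (x + x') \<le> p ((x + x') + (t + s) *\<^sub>R y) - (t + s) * p y"
        using p s t by (intro sublinear_shift_le) auto
      moreover have "p ((x + x') + (t + s) *\<^sub>R y) \<le> p (x + t *\<^sub>R y) + p (x' + s *\<^sub>R y)"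
        using sublinear_add[OF p, of "x + t *\<^sub>R y" "x' + s *\<^sub>R y"]
        by (simp add: algebra_simps)
      ultimately show "?s (x + x') - (p (x' + s *\<^sub>R y) - s * p y) \<le> p (x + t *\<^sub>R y) - t * p y"
        by (simp add: algebra_simps)
    qed
    then show "?s (x + x') - ?s x \<le> p (x' + s *\<^sub>R y) - s * p y" by simp
  qed
  then show "?s (x + x') \<le> ?s x + ?s x'" by simp
next
  fix c :: real and x assume c: "c > 0"
  let ?s = "sublinear_shift p y"
  have "?s (c *\<^sub>R x) / c \<le> ?s x"
  proof (rule le_sublinear_shift)
    fix t :: real assume t: "t \<ge> 0"
    have "?s (c *\<^sub>R x) \<le> p (c *\<^sub>R x + (c * t) *\<^sub>R y) - (c * t) * p y"
      using p c t by (intro sublinear_shift_le) auto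
    also have "c *\<^sub>R x + (c * t) *\<^sub>R y = c *\<^sub>R (x + t *\<^sub>R y)"
      by (simp add: algebra_simps)
    also have "p \<dots> = c * p (x + t *\<^sub>R y)"
      using p c by (simp add: sublinear_scale)
    finally show "?s (c *\<^sub>R x) / c \<le> p (x + t *\<^sub>R y) - t * p y"
      using c by (simp add: field_simps)
  qed
  then show "?s (c *\<^sub>R x) \<le> c * ?s x"
    using c by (simp add: field_simps)
qed

text \<open>Zorn's lemma for the reversed pointwise order. A nonempty chain has its pointwise
  infimum as lower bound, which is finite because every member is at least \<open>- p (- x)\<close>
  at \<open>x\<close>.\<close>

lemma exists_minimal_sublinear:
  fixes p :: "'a::real_vector \<Rightarrow> real"
  assumes p: "sublinear p"
  shows "\<exists>m. sublinear m \<and> m \<le> p \<and> (\<forall>q. sublinear q \<and> q \<le> m \<longrightarrow> q = m)"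
proof -
  define A where "A = {q. sublinear q \<and> q \<le> p}"
  have "\<exists>m\<in>A. \<forall>q\<in>A. q \<le> m \<longrightarrow> q = m"
  proof (rule predicate_Zorn)
    show "partial_order_on A (relation_of (\<lambda>x y. y \<le> x) A)"
      by (rule partial_order_on_relation_ofI) auto
  next
    fix C assume "C \<in> Chains (relation_of (\<lambda>x y. y \<le> x) A)"
    then have CA: "C \<subseteq> A" and tot: "\<And>q r. q \<in> C \<Longrightarrow> r \<in> C \<Longrightarrow> q \<le> r \<or> r \<le> q"
      unfolding Chains_def relation_of_def by auto
    show "\<exists>u\<in>A. \<forall>a\<in>C. u \<le> a"
    proof (cases "C = {}")
      case True
      then show ?thesis using p by (auto simp: A_def)
    next
      case False
      define u where "u x = (INF q\<in>C. q x)" for x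
      have sub: "sublinear q" and qp: "q x \<le> p x" if "q \<in> C" for q x
        using that CA by (auto simp: A_def le_fun_def)
      have lower: "u x \<le> q x" if "q \<in> C" for q x
        unfolding u_def
      proof (rule cINF_lower)
        show "bdd_below ((\<lambda>q. q x) ` C)"
        proof (rule bdd_belowI2)
          fix r assume "r \<in> C"
          then show "- p (- x) \<le> r x"
            using sublinear_minus[OF sub, of r x] qp[of r "- x"] by simp
        qed
      qed (fact that)
      have greatest: "a \<le> u x" if "\<And>q. q \<in> C \<Longrightarrow> a \<le> q x" for a x
        unfolding u_def using False that by (rule cINF_greatest)
      have "sublinear u"
        unfolding sublinear_def
      proof (intro conjI allI impI)
        fix x y
        have "u (x + y) - u y \<le> u x"
        proof (rule greatest)
          fix q assume q: "q \<in> C"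
          have "u (x + y) - q x \<le> u y"
          proof (rule greatest)
            fix r assume r: "r \<in> C"
            \<comment> \<open>Subadditivity of an infimum may fail for arbitrary families; in a
              chain, one member lies below both \<open>q\<close> and \<open>r\<close> and its own
              subadditivity can be used.\<close>
            obtain s where s: "s \<in> C" "s \<le> q" "s \<le> r"
              using tot[OF q r] q r by blast
            have "u (x + y) \<le> s x + s y"
              using lower[OF s(1), of "x + y"] sublinear_add[OF sub[OF s(1)], of x y] by simp
            then show "u (x + y) - q x \<le> r y"
              using le_funD[OF s(2), of x] le_funD[OF s(3), of y] by simp
          qed
          then show "u (x + y) - u y \<le> q x" by simp
        qed
        then show "u (x + y) \<le> u x + u y" by simp
      next
        fix c :: real and x assume c: "c > 0"
        have "u (c *\<^sub>R x) / c \<le> u x"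
        proof (rule greatest)
          fix q assume q: "q \<in> C"
          show "u (c *\<^sub>R x) / c \<le> q x"
            using lower[OF q, of "c *\<^sub>R x"] sublinear_scale[OF sub[OF q], of c x] c
            by (simp add: field_simps)
        qed
        then show "u (c *\<^sub>R x) \<le> c * u x"
          using c by (simp add: field_simps)
      qed
      moreover have "u \<le> p"
        using False lower qp by (metis all_not_in_conv le_funI order_trans)
      ultimately show ?thesis
        using lower by (auto simp: A_def le_fun_def intro!: bexI[of _ u])
    qed
  qed
  then show ?thesis
    unfolding A_def by (metis (mono_tags, lifting) mem_Collect_eq order_trans)
qed

text \<open>A minimal functional is taken below the shift of \<open>p\<close> at \<open>z\<close>
  instead of below \<open>p\<close> itself: this forces the value at \<open>- z\<close> down to
  \<open>- p z\<close>, hence the value at \<open>z\<close> up to \<open>p z\<close>. Minimality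
  against its own shifts then makes it linear.\<close>

theorem Hahn_Banach_sublinear:
  fixes p :: "'a::real_vector \<Rightarrow> real"
  assumes p: "sublinear p"
  shows "\<exists>g. linear g \<and> g \<le> p \<and> g z = p z"
proof -
  obtain m where m: "sublinear m" "m \<le> sublinear_shift p z"
    and min: "\<And>q. sublinear q \<Longrightarrow> q \<le> m \<Longrightarrow> q = m"
    using exists_minimal_sublinear[OF sublinear_sublinear_shift[OF p]] by blast
  have mp: "m \<le> p"
  proof (rule le_funI)
    fix x
    show "m x \<le> p x"
      using le_funD[OF m(2), of x] sublinear_shift_le[OF p order_refl, of z x] by simp
  qed
  have "m x + m y \<le> m (x + y)" for x y
  proof -
    have "sublinear_shift m y \<le> m"
      using sublinear_shift_le[OF m(1) order_refl, of y] by (simp add: le_fun_def)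
    then have "sublinear_shift m y = m"
      using min sublinear_sublinear_shift[OF m(1)] by blast
    then show ?thesis
      using sublinear_shift_le[OF m(1), of 1 y x] by simp
  qed
  then have lin: "linear m"
    using m(1) by (intro sublinear_superadditive_imp_linear)
  have "m (- z) \<le> - p z"
    using le_funD[OF m(2), of "- z"] sublinear_shift_le[OF p, of 1 z "- z"]
      sublinear_zero[OF p] by simp
  then have "p z \<le> m z"
    using linear_neg[OF lin, of z] by simp
  with mp lin show ?thesis
    using le_funD[OF mp, of z] by (intro exI[of _ m]) simp
qed

section \<open>Scaled copies of a convex body as intersections of half-spaces\<close>

text \<open>The polar set of \<open>F\<close>, with a one-sided bound because \<open>F\<close> need
  not be symmetric.\<close>

definition polar_functionals :: "'a::real_normed_vector set \<Rightarrow> ('a \<Rightarrow> real) set" where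
  "polar_functionals F = {g. bounded_linear g \<and> (\<forall>f\<in>F. g f \<le> 1)}"

lemma convex_zero_scale_mem:
  assumes "convex F" "0 \<in> F" "x \<in> F" "0 \<le> c" "c \<le> 1"
  shows "c *\<^sub>R x \<in> F"
  using convexD[OF assms(1) assms(3) assms(2), of c "1 - c"] assms by simp

text \<open>Hahn--Banach for the Minkowski gauge of \<open>F\<close> at \<open>z\<close>. A ball
  inside \<open>F\<close> bounds the gauge by a multiple of the norm, so the functional is bounded;
  the gauge is at most 1 on \<open>F\<close>, and closedness makes it exceed 1 at
  \<open>z\<close>.\<close>

lemma polar_separation:
  fixes F :: "'a::real_normed_vector set"
  assumes F: "closed F" "convex F" "0 \<in> interior F" and z: "z \<notin> F"
  shows "\<exists>g\<in>polar_functionals F. g z > 1"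
proof -
  obtain e where e: "e > 0" "cball 0 e \<subseteq> F"
    using F(3) unfolding mem_interior_cball by blast
  have F0: "0 \<in> F" using F(3) interior_subset by blast
  define G where "G x = {t::real. 0 < t \<and> (1 / t) *\<^sub>R x \<in> F}" for x
  define p where "p x = Inf (G x)" for x \<comment> \<open>the Minkowski gauge of \<open>F\<close>\<close>
  have G_big: "t \<in> G x" if "t > 0" "norm x \<le> e * t" for t x
    using that e unfolding G_def by (auto simp: field_simps dist_norm intro!: subsetD[OF e(2)])
  have ne: "G x \<noteq> {}" for x
    \<comment> \<open>The summand 1 keeps the parameter positive when \<open>x = 0\<close>.\<close>
    using G_big[of "norm x / e + 1" x] e by (fastforce simp: field_simps add_pos_nonneg)
  have lower: "p x \<le> t" if "t \<in> G x" for t x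
    unfolding p_def using that
    by (intro cInf_lower bdd_belowI[of _ 0]) (auto simp: G_def)
  have greatest: "a \<le> p x" if "\<And>t. t \<in> G x \<Longrightarrow> a \<le> t" for a x
    unfolding p_def using ne that by (rule cInf_greatest)
  have p_le: "p x \<le> norm x / e" for x
  proof (rule field_le_epsilon)
    fix d :: real assume d: "d > 0"
    show "p x \<le> norm x / e + d"
      using d e by (intro lower G_big) (auto simp: field_simps add_nonneg_pos)
  qed
  have G_add: "s + t \<in> G (x + y)" if s: "s \<in> G x" and t: "t \<in> G y" for s t x y
  proof -
    have pos: "s > 0" "t > 0" and mem: "(1/s) *\<^sub>R x \<in> F" "(1/t) *\<^sub>R y \<in> F"
      using s t by (auto simp: G_def)
    \<comment> \<open>This convex combination equals \<open>x + y\<close> divided by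
      \<open>s + t\<close>.\<close>
    have "(s/(s+t)) *\<^sub>R (1/s) *\<^sub>R x + (t/(s+t)) *\<^sub>R (1/t) *\<^sub>R y \<in> F"
      using pos by (intro convexD[OF F(2) mem]) (auto simp: add_divide_distrib[symmetric])
    then show ?thesis
      using pos by (simp add: G_def scaleR_add_right)
  qed
  have sub: "sublinear p"
    unfolding sublinear_def
  proof (intro conjI allI impI)
    fix x y
    have "p (x + y) - p y \<le> p x"
    proof (rule greatest)
      fix s assume s: "s \<in> G x"
      have "p (x + y) - s \<le> p y"
      proof (rule greatest)
        fix t assume t: "t \<in> G y"
        show "p (x + y) - s \<le> t"
          using lower[OF G_add[OF s t]] by simp
      qed
      then show "p (x + y) - p y \<le> s" by simp
    qed
    then show "p (x + y) \<le> p x + p y" by simp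
  next
    fix c :: real and x assume c: "c > 0"
    have "p (c *\<^sub>R x) / c \<le> p x"
    proof (rule greatest)
      fix t assume "t \<in> G x"
      then have "c * t \<in> G (c *\<^sub>R x)" using c by (auto simp: G_def)
      then show "p (c *\<^sub>R x) / c \<le> t"
        using lower c by (fastforce simp: field_simps)
    qed
    then show "p (c *\<^sub>R x) \<le> c * p x" using c by (simp add: field_simps)
  qed
  have pz: "p z > 1"
  proof (rule ccontr)
    assume "\<not> p z > 1"
    \<comment> \<open>A gauge value of at most 1 puts slightly shrunken copies of \<open>z\<close>
      into \<open>F\<close>; letting \<open>d\<close> tend to 0 contradicts closedness.\<close>
    have mem: "(1 / (1 + d)) *\<^sub>R z \<in> F" if d: "d > 0" for d
    proof -
      have "p z < 1 + d" using \<open>\<not> p z > 1\<close> d by simp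
      then obtain t where t: "t \<in> G z" "t < 1 + d"
        unfolding p_def using ne cInf_lessD by blast
      then have "(t / (1 + d)) *\<^sub>R (1 / t) *\<^sub>R z \<in> F"
        by (intro convex_zero_scale_mem[OF F(2) F0, of "(1 / t) *\<^sub>R z"]) (auto simp: G_def)
      then show ?thesis using t by (simp add: G_def)
    qed
    have lim: "(\<lambda>n. (1 / (1 + inverse (real (Suc n)))) *\<^sub>R z) \<longlonglongrightarrow> (1 / (1 + 0)) *\<^sub>R z"
      by (intro tendsto_intros LIMSEQ_inverse_real_of_nat) simp
    have "(1 / (1 + inverse (real (Suc n)))) *\<^sub>R z \<in> F" for n
      by (rule mem) simp
    then have "(1 / (1 + 0)) *\<^sub>R z \<in> F"
      using lim by (rule closed_sequentially[OF F(1)])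
    then have "z \<in> F" by simp
    with z show False by simp
  qed
  obtain g where g: "linear g" "g \<le> p" "g z = p z"
    using Hahn_Banach_sublinear[OF sub] by blast
  have gp: "g x \<le> p x" for x using g(2) by (rule le_funD)
  have "\<bar>g x\<bar> \<le> norm x * (1 / e)" for x
    using order_trans[OF gp p_le, of x] order_trans[OF gp p_le, of "- x"] linear_neg[OF g(1), of x]
    by simp
  then have "bounded_linear g"
    using g(1) by (intro bounded_linear_intro[of _ "1 / e"]) (auto simp: linear_add linear_scale)
  moreover have "g f \<le> 1" if "f \<in> F" for f
    using that lower[of 1 f] gp[of f] by (simp add: G_def)
  ultimately show ?thesis
    using pz g(3) by (auto simp: polar_functionals_def)
qed

text \<open>For \<open>t > 0\<close> the converse is separation applied to \<open>z\<close> divided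
  by \<open>t\<close>. For \<open>t = 0\<close> it comes from boundedness of \<open>F\<close>,
  through arbitrarily small positive factors.\<close>

lemma scaled_mem_iff_polar:
  fixes F :: "'a::real_normed_vector set"
  assumes F: "closed F" "bounded F" "convex F" "0 \<in> interior F" and t: "t \<ge> 0"
  shows "z \<in> (*\<^sub>R) t ` F \<longleftrightarrow> (\<forall>g\<in>polar_functionals F. g z \<le> t)"
proof
  assume "z \<in> (*\<^sub>R) t ` F"
  then obtain f where f: "f \<in> F" "z = t *\<^sub>R f" by blast
  show "\<forall>g\<in>polar_functionals F. g z \<le> t"
  proof
    fix g assume "g \<in> polar_functionals F"
    then have "g z = t * g f" "g f \<le> 1"
      using f by (auto simp: polar_functionals_def linear_scale bounded_linear.linear)
    then show "g z \<le> t" using t mult_left_le by simp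
  qed
next
  assume z: "\<forall>g\<in>polar_functionals F. g z \<le> t"
  \<comment> \<open>Stated for every positive \<open>s\<close> from \<open>t\<close> upwards, so
    that it can also be used when \<open>t = 0\<close>.\<close>
  have pos: "(1 / s) *\<^sub>R z \<in> F" if s: "s > 0" "t \<le> s" for s
  proof (rule ccontr)
    assume "(1 / s) *\<^sub>R z \<notin> F"
    then obtain g where g: "g \<in> polar_functionals F" "g ((1 / s) *\<^sub>R z) > 1"
      using polar_separation[OF F(1,3,4)] by blast
    then have "g z > s"
      using s by (auto simp: polar_functionals_def linear_scale bounded_linear.linear field_simps)
    then show False using z g(1) s by force
  qed
  have F0: "0 \<in> F" using F(4) interior_subset by blast
  show "z \<in> (*\<^sub>R) t ` F"
  proof (cases "t = 0")
    case False
    then show ?thesis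
      using pos[of t] t by (intro image_eqI[of _ _ "(1 / t) *\<^sub>R z"]) auto
  next
    case True
    obtain M where M: "M > 0" "\<And>f. f \<in> F \<Longrightarrow> norm f \<le> M"
      using F(2) by (auto simp: bounded_pos)
    \<comment> \<open>With \<open>s = d / M\<close>, the vector \<open>z\<close> is \<open>s\<close>
      times an element of \<open>F\<close>, so its norm is at most \<open>d\<close>.\<close>
    have "norm z \<le> 0 + d" if "d > 0" for d
      using M(2)[OF pos[of "d / M"]] that M(1) True by (simp add: field_simps)
    then have "z = 0" using field_le_epsilon[of "norm z" 0] by simp
    then show ?thesis using F0 by force
  qed
qed

text \<open>Raising the bound weakens every half-space inequality. This nests the feasible sets for
  the compactness argument.\<close>

lemma scaled_mem_mono:
  fixes F :: "'a::real_normed_vector set"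
  assumes F: "closed F" "bounded F" "convex F" "0 \<in> interior F" and st: "0 \<le> s" "s \<le> t"
    and z: "z \<in> (*\<^sub>R) s ` F"
  shows "z \<in> (*\<^sub>R) t ` F"
proof -
  have "\<forall>g\<in>polar_functionals F. g z \<le> s"
    using scaled_mem_iff_polar[OF F st(1)] z by blast
  then have "\<forall>g\<in>polar_functionals F. g z \<le> t"
    using st(2) order_trans by blast
  then show ?thesis
    using scaled_mem_iff_polar[OF F order_trans[OF st]] by blast
qed

lemma scaled_translate_meets_iff:
  "scaled_translate x t F \<inter> S \<noteq> {} \<longleftrightarrow> (\<exists>y\<in>S. y - x \<in> (*\<^sub>R) t ` F)"
proof -
  have "y \<in> scaled_translate x t F \<longleftrightarrow> y - x \<in> (*\<^sub>R) t ` F" for y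
    unfolding scaled_translate_def image_iff mem_Collect_eq Bex_def
    by (simp add: diff_eq_eq add.commute conj_commute)
  then show ?thesis by blast
qed

section \<open>Existence of a smallest ball\<close>

text \<open>\<open>D 0\<close> is the constraint set \<open>\<Omega>\<close>.\<close>

lemma exists_smallest_intersecting_ball:
  fixes F :: "'a::real_normed_vector set" and W :: "'a topology" and D :: "nat \<Rightarrow> 'a set"
  assumes F: "closed F" "bounded F" "convex F" "0 \<in> interior F"
    and top: "topspace W = UNIV"
    and cont: "\<And>g :: 'a \<Rightarrow> real. bounded_linear g \<Longrightarrow> continuous_map W euclideanreal g"
    and cpt: "\<And>R. \<exists>K. compactin W K \<and> cball 0 R \<subseteq> K"
    and cl: "\<And>i. i \<le> n \<Longrightarrow> closedin W (D i)"
    and ne: "\<And>i. i \<le> n \<Longrightarrow> D i \<noteq> {}"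
    and bdd: "\<exists>j\<le>n. bounded (D j)"
  shows "\<exists>r\<ge>0. \<exists>x0\<in>D 0.
           (\<forall>i\<in>{1..n}. scaled_translate x0 r F \<inter> D i \<noteq> {}) \<and>
           (\<forall>x\<in>D 0. \<forall>t\<ge>0.
              (\<forall>i\<in>{1..n}. scaled_translate x t F \<inter> D i \<noteq> {}) \<longrightarrow> r \<le> t)"
proof -
  define X where "X = product_topology (\<lambda>_::nat. W) {..n}"
  define A where "A t = {p \<in> PiE {..n} D. \<forall>i\<in>{1..n}. p i - p 0 \<in> (*\<^sub>R) t ` F}" for t
  define S where "S = {t. 0 \<le> t \<and> A t \<noteq> {}}"
  have topX: "topspace X = PiE {..n} (\<lambda>_. UNIV)"
    by (simp add: X_def top)
  have A_iff: "A t \<noteq> {} \<longleftrightarrow> (\<exists>x\<in>D 0. \<forall>i\<in>{1..n}. scaled_translate x t F \<inter> D i \<noteq> {})" for t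
  proof
    assume "A t \<noteq> {}"
    then show "\<exists>x\<in>D 0. \<forall>i\<in>{1..n}. scaled_translate x t F \<inter> D i \<noteq> {}"
      unfolding A_def scaled_translate_meets_iff by (fastforce simp: PiE_iff)
  next
    assume "\<exists>x\<in>D 0. \<forall>i\<in>{1..n}. scaled_translate x t F \<inter> D i \<noteq> {}"
    then obtain x y where x: "x \<in> D 0"
      and y: "\<And>i. i \<in> {1..n} \<Longrightarrow> y i \<in> D i \<and> y i - x \<in> (*\<^sub>R) t ` F"
      unfolding scaled_translate_meets_iff by metis
    define p where "p = restrict (\<lambda>i. if i = 0 then x else y i) {..n}"
    have p: "p 0 = x" "\<And>i. i \<in> {1..n} \<Longrightarrow> p i = y i" by (auto simp: p_def)
    have "p i \<in> D i" if "i \<le> n" for i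
      using p x y that by (cases "i = 0") auto
    then have "p \<in> PiE {..n} D" by (auto simp: p_def)
    then have "p \<in> A t" using p y by (simp add: A_def)
    then show "A t \<noteq> {}" by blast
  qed
  have A_mono: "A s \<subseteq> A t" if "0 \<le> s" "s \<le> t" for s t
    using scaled_mem_mono[OF F that] by (auto simp: A_def)
  have A_closed: "closedin X (A t)" if t: "t \<ge> 0" for t
  proof -
    \<comment> \<open>The condition is written as a difference of two values of \<open>g\<close>,
      not as \<open>g\<close> of a difference: only functionals, not subtraction, are assumed
      continuous for \<open>W\<close>.\<close>
    let ?h = "\<lambda>(i, g). {p \<in> topspace X. g (p i) - g (p 0) \<in> {..t}}"
    have A_eq: "A t = \<Inter> (insert (PiE {..n} D) (?h ` ({1..n} \<times> polar_functionals F)))"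
    proof -
      have "p \<in> A t \<longleftrightarrow> p \<in> PiE {..n} D \<and>
          (\<forall>i\<in>{1..n}. \<forall>g\<in>polar_functionals F. g (p i) - g (p 0) \<le> t)" for p
        by (simp add: A_def scaled_mem_iff_polar[OF F t] polar_functionals_def
            bounded_linear.linear linear_diff)
      moreover have "PiE {..n} D \<subseteq> topspace X" unfolding topX by (intro PiE_mono) simp
      ultimately show ?thesis by (simp add: set_eq_iff) blast
    qed
    have "closedin X (PiE {..n} D)"
      using cl by (simp add: X_def closedin_product_topology)
    moreover have "closedin X (?h (i, g))" if "i \<in> {1..n}" "g \<in> polar_functionals F" for i g
    proof -
      have g: "continuous_map W euclideanreal g"
        using that cont by (simp add: polar_functionals_def)
      have coord: "continuous_map X euclideanreal (\<lambda>p. g (p k))" if "k \<le> n" for k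
      proof -
        have "continuous_map X W (\<lambda>p. p k)"
          unfolding X_def using that by (intro continuous_map_product_projection) simp
        from continuous_map_compose[OF this g] show ?thesis by (simp add: o_def)
      qed
      have "continuous_map X euclideanreal (\<lambda>p. g (p i) - g (p 0))"
        using that by (intro continuous_map_diff coord) auto
      from closedin_continuous_map_preimage[OF this, of "{..t}"] show ?thesis by simp
    qed
    ultimately show ?thesis unfolding A_eq by (intro closedin_Inter) auto
  qed
  have "S \<noteq> {}"
  proof -
    obtain e where e: "e > 0" "cball 0 e \<subseteq> F"
      using F(4) unfolding mem_interior_cball by blast
    have "PiE {..n} D \<noteq> {}" using ne by (simp add: PiE_eq_empty_iff)
    then obtain d where d: "d \<in> PiE {..n} D" by blast
    \<comment> \<open>Chosen so that \<open>e * t\<close> dominates every distance from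
      \<open>d i\<close> to \<open>d 0\<close>; the summand 1 makes \<open>t\<close> positive even
      if all these distances vanish.\<close>
    define t where "t = (\<Sum>i\<le>n. norm (d i - d 0)) / e + 1"
    have t: "t > 0" using e by (simp add: t_def add_nonneg_pos sum_nonneg)
    have "d i - d 0 \<in> (*\<^sub>R) t ` F" if "i \<in> {1..n}" for i
    proof -
      have "norm (d i - d 0) \<le> (\<Sum>i\<le>n. norm (d i - d 0))"
        using that by (intro member_le_sum) auto
      also have "\<dots> \<le> e * t" using e by (simp add: t_def field_simps)
      finally have "(1 / t) *\<^sub>R (d i - d 0) \<in> F"
        using t by (intro subsetD[OF e(2)]) (simp add: divide_le_eq flip: scaleR_diff_right)
      then have "t *\<^sub>R ((1 / t) *\<^sub>R (d i - d 0)) \<in> (*\<^sub>R) t ` F"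
        by (rule imageI)
      then show ?thesis using t by simp
    qed
    then have "d \<in> A t" using d by (simp add: A_def)
    then have "t \<in> S" unfolding S_def using t by auto
    then show ?thesis by blast
  qed
  then obtain t0 where t0: "t0 \<in> S" by blast
  obtain M where M: "\<And>f. f \<in> F \<Longrightarrow> norm f \<le> M"
    using F(2) by (auto simp: bounded_iff)
  obtain j L where j: "j \<le> n" and L: "\<And>x. x \<in> D j \<Longrightarrow> norm x \<le> L"
    using bdd by (auto simp: bounded_iff)
  \<comment> \<open>The path from \<open>p i\<close> through \<open>p 0\<close> to
    \<open>p j\<close> has two legs of length at most \<open>t0 * M\<close>, and \<open>p j\<close>
    lies in the bounded set.\<close>
  have A_bound: "norm (p i) \<le> L + 2 * (t0 * M)" if p: "p \<in> A t0" and i: "i \<le> n" for p i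
  proof -
    have t0': "t0 \<ge> 0" using t0 by (simp add: S_def)
    have "norm (p k - p 0) \<le> t0 * M" if "k \<le> n" for k
    proof (cases "k = 0")
      case True
      have "0 \<le> M" using M[of 0] F(4) interior_subset by force
      then show ?thesis using True t0' by simp
    next
      case False
      then have "p k - p 0 \<in> (*\<^sub>R) t0 ` F"
        using p that by (simp add: A_def)
      then obtain f where "f \<in> F" "p k - p 0 = t0 *\<^sub>R f" by blast
      then show ?thesis using M t0' by (simp add: mult_left_mono)
    qed
    from this[OF i] this[OF j] have "norm (p i - p j) \<le> 2 * (t0 * M)"
      using norm_triangle_ineq4[of "p i - p 0" "p j - p 0"] by simp
    moreover have "norm (p j) \<le> L"
      using p j by (intro L) (auto simp: A_def)
    ultimately show ?thesis
      using norm_triangle_ineq[of "p i - p j" "p j"] by simp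
  qed
  obtain K where K: "compactin W K" "cball 0 (L + 2 * (t0 * M)) \<subseteq> K"
    using cpt by blast
  have C: "compactin X (PiE {..n} (\<lambda>_. K))"
    using K(1) by (simp add: X_def compactin_PiE)
  have AC: "A t0 \<subseteq> PiE {..n} (\<lambda>_. K)"
  proof
    fix p assume p: "p \<in> A t0"
    have "p i \<in> K" if "i \<le> n" for i
      using A_bound[OF p that] by (intro subsetD[OF K(2)]) simp
    then show "p \<in> PiE {..n} (\<lambda>_. K)"
      using p by (auto simp: A_def PiE_iff)
  qed
  have "PiE {..n} (\<lambda>_. K) \<inter> \<Inter> (A ` S) \<noteq> {}"
  proof -
    have "PiE {..n} (\<lambda>_. K) \<inter> \<Inter> \<F> \<noteq> {}" if fin: "finite \<F>" and sub: "\<F> \<subseteq> A ` S" for \<F>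
    proof -
      obtain Q where Q: "Q \<subseteq> S" "finite Q" "\<F> = A ` Q"
        using finite_subset_image[OF fin sub] by blast
      \<comment> \<open>By nesting, \<open>A m\<close> lies in every member of the finite family.
        Including \<open>t0\<close> makes the minimum meaningful for empty \<open>Q\<close> and
        keeps \<open>A m\<close> inside the compact product.\<close>
      define m where "m = Min (insert t0 Q)"
      have m: "m \<in> insert t0 Q" "\<And>t. t \<in> insert t0 Q \<Longrightarrow> m \<le> t"
        using Q(2) Min_in[of "insert t0 Q"] by (auto simp: m_def)
      then have "m \<in> S" using Q(1) t0 by blast
      then obtain p where p: "p \<in> A m" and "m \<ge> 0" by (auto simp: S_def)
      then have "p \<in> A t" if "t \<in> insert t0 Q" for t
        using that m(2) A_mono by blast
      then have "p \<in> PiE {..n} (\<lambda>_. K) \<inter> \<Inter> \<F>"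
        using AC Q(3) by blast
      then show ?thesis by blast
    qed
    moreover have "\<forall>B\<in>A ` S. closedin X B" using A_closed by (auto simp: S_def)
    ultimately show ?thesis using C unfolding compactin_fip by blast
  qed
  then obtain p where p: "\<And>t. t \<in> S \<Longrightarrow> p \<in> A t" by blast
  define r where "r = Inf S"
  have r_le: "r \<le> t" if "t \<in> S" for t
    unfolding r_def using that by (intro cInf_lower bdd_belowI[of _ 0]) (auto simp: S_def)
  have r0: "r \<ge> 0"
    unfolding r_def using \<open>S \<noteq> {}\<close> by (intro cInf_greatest) (auto simp: S_def)
  \<comment> \<open>One tuple satisfies the inequalities for every feasible \<open>t\<close>, so
    they persist at the infimum.\<close>
  have "p i - p 0 \<in> (*\<^sub>R) r ` F" if i: "i \<in> {1..n}" for i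
    unfolding scaled_mem_iff_polar[OF F r0]
  proof
    fix g assume g: "g \<in> polar_functionals F"
    show "g (p i - p 0) \<le> r"
      unfolding r_def
    proof (rule cInf_greatest[OF \<open>S \<noteq> {}\<close>])
      fix t assume t: "t \<in> S"
      then have "p i - p 0 \<in> (*\<^sub>R) t ` F"
        using p i by (auto simp: A_def)
      moreover have "t \<ge> 0" using t by (simp add: S_def)
      ultimately show "g (p i - p 0) \<le> t"
        using g scaled_mem_iff_polar[OF F] by blast
    qed
  qed
  then have "p \<in> A r"
    using p[OF t0] by (simp add: A_def)
  then obtain x0 where x0: "x0 \<in> D 0" "\<forall>i\<in>{1..n}. scaled_translate x0 r F \<inter> D i \<noteq> {}"
    using A_iff by blast
  have "r \<le> t"
    if "x \<in> D 0" "t \<ge> 0" "\<forall>i\<in>{1..n}. scaled_translate x t F \<inter> D i \<noteq> {}" for x t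
  proof (rule r_le)
    have "A t \<noteq> {}" using that(1,3) unfolding A_iff by (rule bexI[rotated])
    then show "t \<in> S" using that(2) by (simp add: S_def)
  qed
  then show ?thesis using r0 x0 by (intro exI[of _ r] conjI bexI[of _ x0]) auto
qed

section \<open>Weak compactness in reflexive spaces\<close>

lemma topspace_weak_topology: "topspace (weak_topology :: 'a::real_normed_vector topology) = UNIV"
proof -
  have "UNIV \<in> {blinfun_apply f -` U | (f :: 'a \<Rightarrow>\<^sub>L real) U. open U}"
    by (force intro: exI[of _ UNIV])
  then show ?thesis unfolding weak_topology_def by auto
qed

lemma continuous_map_weak_topology:
  fixes g :: "'a::real_normed_vector \<Rightarrow> real"
  assumes "bounded_linear g"
  shows "continuous_map weak_topology euclideanreal g"
proof -
  have "openin weak_topology (g -` U)" if "open U" for U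
  proof -
    have "g -` U = blinfun_apply (Blinfun g) -` U"
      using assms by (simp add: bounded_linear_Blinfun_apply)
    then show ?thesis
      unfolding weak_topology_def using that by (intro topology_generated_by_Basis) blast
  qed
  then show ?thesis
    by (simp add: continuous_map_alt topspace_weak_topology)
qed

text \<open>The half-space description of the unit ball scaled by 0, which is the single point 0, is
  applied to \<open>x - y\<close>.\<close>

lemma blinfun_real_separates_points:
  fixes x y :: "'a::real_normed_vector"
  assumes "\<And>f :: 'a \<Rightarrow>\<^sub>L real. blinfun_apply f x = blinfun_apply f y"
  shows "x = y"
proof -
  have "g (x - y) \<le> 0" if "g \<in> polar_functionals (cball 0 1)" for g
    using assms[of "Blinfun g"] that
    by (simp add: bounded_linear_Blinfun_apply bounded_linear.linear linear_diff polar_functionals_def)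
  moreover have "0 \<in> interior (cball (0::'a) 1)"
    unfolding mem_interior_cball by (intro exI[of _ 1]) simp
  ultimately have "x - y \<in> (*\<^sub>R) 0 ` cball 0 1"
    by (subst scaled_mem_iff_polar) auto
  then show ?thesis by auto
qed

text \<open>The Banach--Alaoglu argument: the bounds define a product of compact intervals, and
  linearity is closed under pointwise convergence. Plain functions are used so that the topology is
  the product topology.\<close>

lemma compact_bounded_linear_functionals:
  fixes R :: real
  shows "compact {\<phi> :: 'b::real_normed_vector \<Rightarrow> real. linear \<phi> \<and> (\<forall>f. \<bar>\<phi> f\<bar> \<le> R * norm f)}"
proof -
  let ?P = "PiE (UNIV :: 'b set) (\<lambda>f. {- (R * norm f)..R * norm f})"
  have "compactin (product_topology (\<lambda>_. euclideanreal) (UNIV :: 'b set)) ?P"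
    by (simp add: compactin_PiE)
  then have "compact ?P"
    by (simp add: euclidean_product_topology)
  moreover have "closed {\<phi> :: 'b \<Rightarrow> real. linear \<phi>}"
    unfolding linear_iff
    by (intro closed_Collect_conj closed_Collect_all closed_Collect_eq continuous_intros
        continuous_on_product_coordinates)
  ultimately have "compact (?P \<inter> {\<phi>. linear \<phi>})"
    by (rule compact_Int_closed)
  also have "?P \<inter> {\<phi>. linear \<phi>} = {\<phi>. linear \<phi> \<and> (\<forall>f. \<bar>\<phi> f\<bar> \<le> R * norm f)}"
    by (auto simp: PiE_iff abs_le_iff minus_le_iff)
  finally show ?thesis .
qed

text \<open>By reflexivity every functional in the compact set \<open>C\<close> is evaluation at a
  point, so \<open>s\<close> inverts the canonical embedding there. This inverse is continuous into
  the weak topology, and its image contains the ball.\<close>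

lemma reflexive_cball_subset_weakly_compact:
  assumes "reflexive_space TYPE('a::real_normed_vector)"
  shows "\<exists>K. compactin weak_topology K \<and> cball (0::'a) R \<subseteq> K"
proof -
  define C where "C = {\<phi> :: ('a \<Rightarrow>\<^sub>L real) \<Rightarrow> real. linear \<phi> \<and> (\<forall>f. \<bar>\<phi> f\<bar> \<le> R * norm f)}"
  define s :: "(('a \<Rightarrow>\<^sub>L real) \<Rightarrow> real) \<Rightarrow> 'a"
    where "s \<phi> = (SOME x. \<forall>f. \<phi> f = blinfun_apply f x)" for \<phi>
  have s: "\<phi> f = blinfun_apply f (s \<phi>)" if "\<phi> \<in> C" for \<phi> f
  proof -
    have "bounded_linear \<phi>"
      using that by (intro bounded_linear_intro[of _ R])
        (auto simp: C_def linear_add linear_scale mult.commute)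
    then have "\<exists>x. \<forall>f. \<phi> f = blinfun_apply f x"
      using assms unfolding reflexive_space_def by (metis bounded_linear_Blinfun_apply)
    then have "\<forall>f. \<phi> f = blinfun_apply f (s \<phi>)"
      unfolding s_def by (rule someI_ex)
    then show ?thesis by blast
  qed
  have "continuous_map (top_of_set C) weak_topology s"
    unfolding weak_topology_def
  proof (rule continuous_on_generated_topo)
    fix V assume "V \<in> {blinfun_apply f -` U | (f :: 'a \<Rightarrow>\<^sub>L real) U. open U}"
    then obtain f :: "'a \<Rightarrow>\<^sub>L real" and U where V: "V = blinfun_apply f -` U" "open U" by blast
    \<comment> \<open>On \<open>C\<close>, applying \<open>f\<close> after \<open>s\<close> is just
      the coordinate map at \<open>f\<close>, which is continuous for pointwise convergence.\<close>
    have "s -` V \<inter> topspace (top_of_set C) = C \<inter> (\<lambda>\<phi>. \<phi> f) -` U"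
      using s V by auto
    moreover have "openin (top_of_set C) (C \<inter> (\<lambda>\<phi>. \<phi> f) -` U)"
      using V(2) by (intro continuous_openin_preimage_gen continuous_on_subset[OF continuous_on_product_coordinates]) auto
    ultimately show "openin (top_of_set C) (s -` V \<inter> topspace (top_of_set C))" by simp
  next
    show "s ` topspace (top_of_set C) \<subseteq> \<Union> {blinfun_apply f -` U | (f :: 'a \<Rightarrow>\<^sub>L real) U. open U}"
      using topspace_weak_topology[where 'a = 'a] by (simp add: weak_topology_def)
  qed
  moreover have "compactin (top_of_set C) C"
    using compact_bounded_linear_functionals[of R, where 'b = "'a \<Rightarrow>\<^sub>L real"]
    by (simp add: C_def compactin_subtopology)
  ultimately have "compactin weak_topology (s ` C)"
    using image_compactin by blast
  moreover have "cball 0 R \<subseteq> s ` C"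
  proof
    fix x :: 'a assume x: "x \<in> cball 0 R"
    let ?J = "\<lambda>f :: 'a \<Rightarrow>\<^sub>L real. blinfun_apply f x"
    have "\<bar>blinfun_apply f x\<bar> \<le> R * norm f" for f :: "'a \<Rightarrow>\<^sub>L real"
    proof -
      have "norm (blinfun_apply f x) \<le> norm f * norm x" by (rule norm_blinfun)
      also have "\<dots> \<le> norm f * R" using x by (intro mult_left_mono) auto
      finally show ?thesis by (simp add: mult.commute)
    qed
    moreover have "linear ?J"
      by (rule linearI) (simp_all only: blinfun.add_left blinfun.scaleR_left)
    ultimately have J: "?J \<in> C"
      unfolding C_def by blast
    \<comment> \<open>The choice in \<open>s\<close> returns \<open>x\<close> itself because
      functionals separate points.\<close>
    have "x = s ?J"
      by (rule blinfun_real_separates_points) (rule s[OF J])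
    then show "x \<in> s ` C" using J by (rule image_eqI)
  qed
  ultimately show ?thesis by blast
qed

section \<open>Compactness of balls in finite dimension\<close>

text \<open>A convergent sequence is bounded, so it stays in one of the compact pieces. This makes
  \<open>span B\<close> closed in the induction that follows.\<close>

lemma closed_if_compact_cball_Int:
  fixes V :: "'a::real_normed_vector set"
  assumes "\<And>R. compact (cball 0 R \<inter> V)"
  shows "closed V"
proof -
  have "x \<in> V" if v: "v \<longlonglongrightarrow> x" "\<And>n. v n \<in> V" for v x
  proof -
    obtain R where "\<And>n. norm (v n) \<le> R"
      using convergent_imp_bounded[OF v(1)] by (auto simp: bounded_iff)
    then have "\<And>n. v n \<in> cball 0 R \<inter> V" using v(2) by simp
    then show ?thesis
      using closed_sequentially[OF compact_imp_closed[OF assms[of R]]] v(1) by blast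
  qed
  then show ?thesis by (auto simp: closed_sequential_limits)
qed

text \<open>A new vector \<open>b\<close> has positive distance \<open>d\<close> from the closed set
  \<open>span B\<close>. This bounds the coefficient of \<open>b\<close>, so the new piece is a
  closed ball intersected with a continuous image of a compact product.\<close>

lemma compact_cball_Int_span:
  fixes B :: "'a::real_normed_vector set"
  assumes "finite B"
  shows "compact (cball 0 R \<inter> span B)"
  using assms
proof (induction B arbitrary: R rule: finite_induct)
  case empty
  \<comment> \<open>The empty case occurs for negative \<open>R\<close>.\<close>
  have "cball (0::'a) R \<inter> {0} = {} \<or> cball (0::'a) R \<inter> {0} = {0}" by blast
  then show ?case by auto
next
  case (insert b B)
  show ?case
  proof (cases "b \<in> span B")
    case True
    then show ?thesis using insert.IH by (simp add: span_redundant)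
  next
    case False
    have "closed (span B)" by (rule closed_if_compact_cball_Int) (rule insert.IH)
    then have "open (- span B)" by (rule open_Compl)
    then obtain d where "d > 0" and ball: "ball b d \<subseteq> - span B"
      using False by (meson ComplI openE)
    have d: "d > 0" "\<And>v. v \<in> span B \<Longrightarrow> d \<le> dist b v"
      using ball \<open>d > 0\<close> by (auto simp: subset_iff simp flip: not_less)
    define R' where "R' = R + \<bar>R / d\<bar> * norm b"
    let ?h = "\<lambda>(c, v). c *\<^sub>R b + v"
    let ?K = "{- \<bar>R / d\<bar>..\<bar>R / d\<bar>} \<times> (cball 0 R' \<inter> span B)"
    have eq: "cball 0 R \<inter> span (insert b B) = cball 0 R \<inter> ?h ` ?K"
    proof (intro equalityI subsetI)
      fix x assume x: "x \<in> cball 0 R \<inter> ?h ` ?K"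
      then obtain c v where cv: "x = c *\<^sub>R b + v" "v \<in> span B" by auto
      have "v \<in> span (insert b B)"
        using cv(2) span_mono[of B "insert b B"] by blast
      then have "x \<in> span (insert b B)"
        unfolding cv(1) by (intro span_add span_scale) (simp_all add: span_base)
      then show "x \<in> cball 0 R \<inter> span (insert b B)" using x by blast
    next
      fix x assume x: "x \<in> cball 0 R \<inter> span (insert b B)"
      then obtain c where c: "x - c *\<^sub>R b \<in> span B" by (auto simp: span_insert)
      have "\<bar>c\<bar> * d \<le> R"
      proof (cases "c = 0")
        case False
        \<comment> \<open>This element of \<open>span B\<close> is \<open>b\<close> minus
          \<open>x\<close> divided by \<open>c\<close>; its distance from \<open>b\<close> is the
          norm of \<open>x\<close> divided by the absolute value of \<open>c\<close>.\<close>
        have "- ((1 / c) *\<^sub>R (x - c *\<^sub>R b)) \<in> span B"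
          using c by (intro span_neg span_scale)
        from d(2)[OF this] have "d \<le> norm ((1 / c) *\<^sub>R x)"
          using False by (simp add: dist_norm scaleR_diff_right)
        then show ?thesis using x False by (simp add: divide_simps mult.commute)
      next
        case True
        have "norm x \<le> R" using x by simp
        then have "0 \<le> R" by (rule order_trans[OF norm_ge_zero])
        then show ?thesis using True by simp
      qed
      then have cb: "\<bar>c\<bar> \<le> \<bar>R / d\<bar>"
        using d(1) abs_ge_self[of "R / d"] by (simp add: pos_le_divide_eq)
      have "norm (x - c *\<^sub>R b) \<le> R'"
        using norm_triangle_ineq4[of x "c *\<^sub>R b"] x mult_right_mono[OF cb norm_ge_zero[of b]]
        by (simp add: R'_def)
      then have "(c, x - c *\<^sub>R b) \<in> ?K" using c cb by auto
      then have "x \<in> ?h ` ?K" by (rule rev_image_eqI) simp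
      then show "x \<in> cball 0 R \<inter> ?h ` ?K" using x by blast
    qed
    have "compact (?h ` ?K)"
    proof (rule compact_continuous_image)
      show "continuous_on ?K ?h"
        unfolding case_prod_unfold by (intro continuous_intros)
      show "compact ?K"
        by (intro compact_Times compact_Icc insert.IH)
    qed
    then show ?thesis
      unfolding eq by (intro closed_Int_compact closed_cball)
  qed
qed

section \<open>The smallest intersecting ball problem\<close>

theorem theorem3p1:
  fixes F \<Omega> :: "'a::real_normed_vector set"
    and T :: "nat \<Rightarrow> 'a set"
    and n :: nat
  assumes "closed F" and "bounded F" and "convex F" and "0 \<in> interior F"
    and "n \<ge> 1"
    and "closed \<Omega>" and "\<Omega> \<noteq> {}"
    and "\<And>i. i \<in> {1..n} \<Longrightarrow> closed (T i)"
    and "\<And>i. i \<in> {1..n} \<Longrightarrow> T i \<noteq> {}"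
    and "(finite_dimensional_space TYPE('a) \<and>
            (bounded \<Omega> \<or> (\<exists>i\<in>{1..n}. bounded (T i)))) \<or>
         (complete (UNIV :: 'a set) \<and> reflexive_space TYPE('a) \<and>
            weakly_closed \<Omega> \<and> (\<forall>i\<in>{1..n}. weakly_closed (T i)) \<and>
            (bounded \<Omega> \<or> (\<exists>i\<in>{1..n}. bounded (T i))))"
  shows "\<exists>r\<ge>0. \<exists>x0\<in>\<Omega>.
           (\<forall>i\<in>{1..n}. scaled_translate x0 r F \<inter> T i \<noteq> {}) \<and>
           (\<forall>x\<in>\<Omega>. \<forall>t\<ge>0.
              (\<forall>i\<in>{1..n}. scaled_translate x t F \<inter> T i \<noteq> {}) \<longrightarrow> r \<le> t)"
proof -
  define D where "D i = (if i = 0 then \<Omega> else T i)" for i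
  have "\<exists>W :: 'a topology. topspace W = UNIV
      \<and> (\<forall>g :: 'a \<Rightarrow> real. bounded_linear g \<longrightarrow> continuous_map W euclideanreal g)
      \<and> (\<forall>R. \<exists>K. compactin W K \<and> cball 0 R \<subseteq> K)
      \<and> closedin W \<Omega> \<and> (\<forall>i\<in>{1..n}. closedin W (T i))"
  \<comment> \<open>The split is on the dimension: the norm topology serves every finite-dimensional
    space, and otherwise the second alternative must hold.\<close>
  proof (cases "finite_dimensional_space TYPE('a)")
    case True
    then obtain B :: "'a set" where B: "finite B" "span B = UNIV"
      unfolding finite_dimensional_space_def by blast
    have "compact (cball (0::'a) R)" for R
      using compact_cball_Int_span[OF B(1), of R] B(2) by simp
    then show ?thesis
      using assms(6,8)
      by (intro exI[of _ euclidean]) (auto simp: linear_continuous_on intro!: exI[of _ "cball _ _"])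
  next
    case False
    then have "reflexive_space TYPE('a)" "weakly_closed \<Omega>" "\<forall>i\<in>{1..n}. weakly_closed (T i)"
      using assms(10) by blast+
    then show ?thesis
      by (intro exI[of _ weak_topology])
        (simp add: topspace_weak_topology continuous_map_weak_topology reflexive_cball_subset_weakly_compact)
  qed
  then obtain W :: "'a topology" where W: "topspace W = UNIV"
      "\<forall>g :: 'a \<Rightarrow> real. bounded_linear g \<longrightarrow> continuous_map W euclideanreal g"
      "\<forall>R. \<exists>K. compactin W K \<and> cball 0 R \<subseteq> K"
      "closedin W \<Omega>" "\<forall>i\<in>{1..n}. closedin W (T i)"
    by (elim exE conjE) (rule that)
  have "\<exists>r\<ge>0. \<exists>x0\<in>D 0.
           (\<forall>i\<in>{1..n}. scaled_translate x0 r F \<inter> D i \<noteq> {}) \<and>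
           (\<forall>x\<in>D 0. \<forall>t\<ge>0.
              (\<forall>i\<in>{1..n}. scaled_translate x t F \<inter> D i \<noteq> {}) \<longrightarrow> r \<le> t)"
  proof (rule exists_smallest_intersecting_ball[OF assms(1-4) W(1) W(2)[rule_format] W(3)[rule_format]])
    show "closedin W (D i)" "D i \<noteq> {}" if "i \<le> n" for i
      using W(4,5) assms(7,9) that by (auto simp: D_def)
    have "bounded \<Omega> \<or> (\<exists>i\<in>{1..n}. bounded (T i))" using assms(10) by blast
    then show "\<exists>j\<le>n. bounded (D j)"
    proof
      assume "bounded \<Omega>"
      then show ?thesis by (intro exI[of _ 0]) (simp add: D_def)
    next
      assume "\<exists>i\<in>{1..n}. bounded (T i)"
      then obtain i where "i \<in> {1..n}" "bounded (T i)" by blast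
      then show ?thesis by (intro exI[of _ i]) (simp add: D_def)
    qed
  qed
  moreover have "D 0 = \<Omega>" "\<And>i. i \<in> {1..n} \<Longrightarrow> D i = T i" by (auto simp: D_def)
  ultimately show ?thesis by simp
qed

end
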